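(* There exists a graph whose circle packings cannot be constructed by a quadratic computation tree; that is, no circle packing representing this graph can be constructed by a quadratic computation tree.
   Context: A circle packing representing a planar graph $G$ is a collection of circles in the plane with pairwise disjoint interiors, one for each vertex, such that the circles of two adjacent vertices are tangent. Points of the plane are identified with complex numbers; constructing a packing means computing the centers and radii of all its circles. An algebraic computation tree is a rooted tree whose computation nodes compute a value as the sum, difference, product or quotient of integer constants and values computed at ancestor nodes, and whose decision nodes test whether a computed value is greater than zero and branch. A quadratic computation tree additionally allows square roots and complex conjugation of previously computed values. *)

theory Defs
  imports "HOL-Analysis.Analysis"
begin

definition simple_graph :: "nat \<Rightarrow> (nat \<Rightarrow> nat \<Rightarrow> bool) \<Rightarrow> bool" where
  "simple_graph n E \<longleftrightarrow>
     (\<forall>i j. E i j \<longrightarrow> i < n \<and> j < n \<and> i \<noteq> j) \<and> (\<forall>i j. E i j \<longrightarrow> E j i)"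

definition circle_packing ::
  "nat \<Rightarrow> (nat \<Rightarrow> nat \<Rightarrow> bool) \<Rightarrow> (nat \<Rightarrow> complex) \<Rightarrow> (nat \<Rightarrow> real) \<Rightarrow> bool" where
  "circle_packing n E c r \<longleftrightarrow>
     (\<forall>i<n. 0 < r i) \<and>
     (\<forall>i<n. \<forall>j<n. i \<noteq> j \<longrightarrow> ball (c i) (r i) \<inter> ball (c j) (r j) = {}) \<and>
     (\<forall>i<n. \<forall>j<n. E i j \<longrightarrow> cmod (c i - c j) = r i + r j)"

text \<open>Operations of computation nodes; natural-number arguments refer (by position)
  to values computed at ancestor nodes.\<close>
datatype qop =
    QConst int
  | QAdd nat nat
  | QSub nat nat
  | QMul nat nat
  | QDiv nat nat
  | QSqrt nat
  | QConj nat

text \<open>A quadratic computation tree: computation nodes, decision nodes (testing whether an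
  ancestor value is greater than zero), and output leaves listing ancestor values.\<close>
datatype qtree =
    QOut "nat list"
  | QComp qop qtree
  | QTest nat qtree qtree

fun qop_val :: "complex list \<Rightarrow> qop \<Rightarrow> complex option" where
  "qop_val vs (QConst k) = Some (of_int k)"
| "qop_val vs (QAdd i j) = (if i < length vs \<and> j < length vs then Some (vs!i + vs!j) else None)"
| "qop_val vs (QSub i j) = (if i < length vs \<and> j < length vs then Some (vs!i - vs!j) else None)"
| "qop_val vs (QMul i j) = (if i < length vs \<and> j < length vs then Some (vs!i * vs!j) else None)"
| "qop_val vs (QDiv i j) =
     (if i < length vs \<and> j < length vs \<and> vs!j \<noteq> 0 then Some (vs!i / vs!j) else None)"
| "qop_val vs (QSqrt i) = (if i < length vs then Some (csqrt (vs!i)) else None)"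
| "qop_val vs (QConj i) = (if i < length vs then Some (cnj (vs!i)) else None)"

fun qrun :: "qtree \<Rightarrow> complex list \<Rightarrow> complex list option" where
  "qrun (QOut is) vs = (if (\<forall>i\<in>set is. i < length vs) then Some (map (\<lambda>i. vs!i) is) else None)"
| "qrun (QComp op t) vs = (case qop_val vs op of None \<Rightarrow> None | Some v \<Rightarrow> qrun t (vs @ [v]))"
| "qrun (QTest i t1 t2) vs =
     (if i < length vs then
        (if vs!i \<in> \<real> \<and> 0 < Re (vs!i) then qrun t1 vs else qrun t2 vs)
      else None)"

definition qtree_constructs ::
  "qtree \<Rightarrow> nat \<Rightarrow> (nat \<Rightarrow> complex) \<Rightarrow> (nat \<Rightarrow> real) \<Rightarrow> bool" where
  "qtree_constructs T n c r \<longleftrightarrow>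
     (\<exists>os. qrun T [] = Some os \<and> length os = 2 * n \<and>
           (\<forall>i<n. os!i = c i \<and> os!(n+i) = complex_of_real (r i)))"

end

(* The graph is the bipyramid over a 7-cycle. In any of its packings the seven rim circles form a
   closed chain tangent to the two apex circles. Up to a Moebius transformation the apexes are
   concentric, so consecutive rim circles differ by a rotation by a fixed angle x with 7 x in
   2 pi Z, and 2 cos x is a root of X^3 + X^2 - 2 X - 1. But 2 cos x is also a rational function of
   the centres and radii of the apexes, via their inversive distance. All values computed by a
   quadratic computation tree lie in a field obtained from the rationals by successively
   adjoining square roots, and such a field contains no root of this irreducible cubic. *)

theory Submission
  imports Defs
begin

section \<open>Numbers computed by a quadratic computation tree\<close>

text \<open>Quotients need no side condition: \<open>x / 0 = 0\<close>, and 0 lies in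
  \<open>F\<close> as \<open>1 - 1\<close>.\<close>

definition complex_subfield :: "complex set \<Rightarrow> bool" where
  "complex_subfield F \<longleftrightarrow> 1 \<in> F \<and>
     (\<forall>x\<in>F. \<forall>y\<in>F. x + y \<in> F \<and> x - y \<in> F \<and> x * y \<in> F \<and> x / y \<in> F)"

text \<open>The minimal polynomial of 2 cos (2 pi / 7) over the rationals.\<close>

definition heptagon_cubic :: "complex \<Rightarrow> complex" where
  "heptagon_cubic x = x^3 + x^2 - 2 * x - 1"

text \<open>If \<open>s^2\<close> lies in the field \<open>F\<close>, this is F(s), of degree at
  most 2 over \<open>F\<close>; \<open>s\<close> may already lie in \<open>F\<close>.\<close>

definition quad_adjoin :: "complex set \<Rightarrow> complex \<Rightarrow> complex set" where
  "quad_adjoin F s = {a + b * s | a b. a \<in> F \<and> b \<in> F}"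

lemma complex_subfieldD:
  assumes "complex_subfield F"
  shows "1 \<in> F" "0 \<in> F" "x \<in> F \<Longrightarrow> y \<in> F \<Longrightarrow> x + y \<in> F" "x \<in> F \<Longrightarrow> y \<in> F \<Longrightarrow> x - y \<in> F"
    "x \<in> F \<Longrightarrow> y \<in> F \<Longrightarrow> x * y \<in> F" "x \<in> F \<Longrightarrow> y \<in> F \<Longrightarrow> x / y \<in> F" "x \<in> F \<Longrightarrow> - x \<in> F"
    "x \<in> F \<Longrightarrow> x ^ k \<in> F"
proof -
  show 1: "1 \<in> F" using assms by (simp add: complex_subfield_def)
  have "1 - 1 \<in> F" using assms unfolding complex_subfield_def by blast
  then show 0: "0 \<in> F" by simp
  show "x \<in> F \<Longrightarrow> y \<in> F \<Longrightarrow> x + y \<in> F" "x \<in> F \<Longrightarrow> y \<in> F \<Longrightarrow> x - y \<in> F"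
    "x \<in> F \<Longrightarrow> y \<in> F \<Longrightarrow> x / y \<in> F" for x y
    using assms unfolding complex_subfield_def by blast+
  show m: "x \<in> F \<Longrightarrow> y \<in> F \<Longrightarrow> x * y \<in> F" for x y
    using assms unfolding complex_subfield_def by blast
  show "- x \<in> F" if "x \<in> F"
  proof -
    have "0 - x \<in> F" using assms 0 that unfolding complex_subfield_def by blast
    then show ?thesis by simp
  qed
  show "x ^ k \<in> F" if "x \<in> F"
    by (induction k) (use 1 m that in auto)
qed

lemma complex_subfield_of_nat:
  assumes "complex_subfield F"
  shows "of_nat n \<in> F"
  by (induction n) (use complex_subfieldD[OF assms] in auto)

lemma complex_subfield_numeral:
  assumes "complex_subfield F"
  shows "numeral n \<in> F"
  using complex_subfield_of_nat[OF assms, of "numeral n"] by simp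

lemma complex_subfield_of_int:
  assumes "complex_subfield F"
  shows "of_int k \<in> F"
  by (cases k rule: int_cases2)
    (use complex_subfield_of_nat[OF assms] complex_subfieldD(7)[OF assms] in auto)

lemma quad_adjoin_superset:
  assumes "complex_subfield F"
  shows "F \<subseteq> quad_adjoin F s" "s \<in> quad_adjoin F s"
proof -
  show "F \<subseteq> quad_adjoin F s"
  proof
    fix x assume "x \<in> F"
    then have "x = x + 0 * s \<and> x \<in> F \<and> 0 \<in> F" using complex_subfieldD[OF assms] by simp
    then show "x \<in> quad_adjoin F s" unfolding quad_adjoin_def by blast
  qed
  have "s = 0 + 1 * s \<and> 0 \<in> F \<and> 1 \<in> F" using complex_subfieldD[OF assms] by simp
  then show "s \<in> quad_adjoin F s" unfolding quad_adjoin_def by blast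
qed

lemma quad_adjoin_subset:
  assumes "complex_subfield F" "s \<in> F"
  shows "quad_adjoin F s = F"
  using quad_adjoin_superset[OF assms(1)] assms complex_subfieldD[OF assms(1)]
  unfolding quad_adjoin_def by auto

lemma complex_subfield_quad_adjoin:
  assumes F: "complex_subfield F" and d: "s^2 \<in> F"
  shows "complex_subfield (quad_adjoin F s)"
proof (cases "s \<in> F")
  case True
  then show ?thesis using quad_adjoin_subset F by simp
next
  case False
  note FD = complex_subfieldD[OF F]
  let ?K = "quad_adjoin F s"
  have I: "x \<in> ?K" if "x = a + b * s" "a \<in> F" "b \<in> F" for x a b
    using that unfolding quad_adjoin_def by blast
  have inverse: "1 / y \<in> ?K" if y: "y \<in> ?K" for y
  proof -
    obtain a b where ab: "y = a + b * s" "a \<in> F" "b \<in> F"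
      using y unfolding quad_adjoin_def by blast
    show ?thesis
    proof (cases "y = 0")
      case True
      then show ?thesis using quad_adjoin_superset(1)[OF F] FD(2) by auto
    next
      case y0: False
      \<comment> \<open>The norm of \<open>y\<close>, used to rationalise the denominator. It is
        nonzero, since a vanishing conjugate \<open>a - b * s\<close> would put
        \<open>s = a / b\<close> into \<open>F\<close>.\<close>
      define n where "n = a^2 - b^2 * s^2"
      have n_eq: "n = y * (a - b * s)" unfolding n_def ab(1) by (simp add: algebra_simps power2_eq_square)
      have "a - b * s \<noteq> 0"
      proof
        assume e: "a - b * s = 0"
        have "b \<noteq> 0" using e y0 ab(1) by auto
        then have "s = a / b" using e by (simp add: field_simps)
        then show False using False FD ab by auto
      qed
      then have n0: "n \<noteq> 0" using n_eq y0 by simp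
      have "1 / y = (a - b * s) / n" using n0 y0 by (simp add: n_eq)
      then have "1 / y = a / n + (- b / n) * s" by (simp add: diff_divide_distrib)
      moreover have "n \<in> F" unfolding n_def using FD d ab by auto
      ultimately show ?thesis using I[of _ "a / n" "- b / n"] FD ab by auto
    qed
  qed
  have mult: "x * y \<in> ?K" if xy: "x \<in> ?K" "y \<in> ?K" for x y
  proof -
    obtain a b where ab: "x = a + b * s" "a \<in> F" "b \<in> F"
      using xy unfolding quad_adjoin_def by blast
    obtain a' b' where ab': "y = a' + b' * s" "a' \<in> F" "b' \<in> F"
      using xy unfolding quad_adjoin_def by blast
    have "x * y = (a * a' + b * b' * s^2) + (a * b' + b * a') * s"
      unfolding ab ab' by (simp add: algebra_simps power2_eq_square)
    then show ?thesis using I FD ab ab' d by auto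
  qed
  have add: "x + y \<in> ?K \<and> x - y \<in> ?K" if xy: "x \<in> ?K" "y \<in> ?K" for x y
  proof -
    obtain a b where ab: "x = a + b * s" "a \<in> F" "b \<in> F"
      using xy unfolding quad_adjoin_def by blast
    obtain a' b' where ab': "y = a' + b' * s" "a' \<in> F" "b' \<in> F"
      using xy unfolding quad_adjoin_def by blast
    have "x + y = (a + a') + (b + b') * s" "x - y = (a - a') + (b - b') * s"
      unfolding ab ab' by (simp_all add: algebra_simps)
    then show ?thesis using I FD(3,4) ab(2,3) ab'(2,3) by blast
  qed
  have "x / y \<in> ?K" if "x \<in> ?K" "y \<in> ?K" for x y
    using mult[OF that(1) inverse[OF that(2)]] by simp
  then show ?thesis
    unfolding complex_subfield_def using mult add quad_adjoin_superset(1)[OF F] FD(1) by blast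
qed

text \<open>If a cubic over \<open>F\<close> has the root \<open>a + b s\<close>, it has the root \<open>a - b s\<close> as well, and the
  third root, here \<open>- 1 - 2 a\<close>, lies in \<open>F\<close>.\<close>

lemma heptagon_cubic_quad_adjoin:
  assumes F: "complex_subfield F" and d: "s^2 \<in> F"
    and no_root: "\<forall>x\<in>F. heptagon_cubic x \<noteq> 0"
  shows "\<forall>x\<in>quad_adjoin F s. heptagon_cubic x \<noteq> 0"
proof (cases "s \<in> F")
  case True
  then show ?thesis using quad_adjoin_subset F no_root by simp
next
  case False
  note FD = complex_subfieldD[OF F] complex_subfield_numeral[OF F]
  show ?thesis
  proof (rule ballI, rule notI)
    fix x assume x: "x \<in> quad_adjoin F s" and root: "heptagon_cubic x = 0"
    obtain a b where ab: "x = a + b * s" "a \<in> F" "b \<in> F"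
      using x unfolding quad_adjoin_def by blast
    define D where "D = s^2"
    \<comment> \<open>Splits the value of the cubic at \<open>a + b * s\<close> into
      \<open>U + V * s\<close> with \<open>U\<close>, \<open>V\<close> in \<open>F\<close>; as
      \<open>s\<close> is outside \<open>F\<close>, both vanish at a root.\<close>
    define U where "U = a^3 + 3 * a * b^2 * D + a^2 + b^2 * D - 2 * a - 1"
    define V where "V = b * (3 * a^2 + b^2 * D + 2 * a - 2)"
    have "U + V * s = heptagon_cubic x"
      unfolding U_def V_def D_def ab heptagon_cubic_def by (simp add: algebra_simps power2_eq_square power3_eq_cube)
    then have UV: "U + V * s = 0" using root by simp
    have UVF: "U \<in> F" "V \<in> F" unfolding U_def V_def D_def using FD d ab by auto
    have V0: "V = 0"
    proof (rule ccontr)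
      assume "V \<noteq> 0"
      then have "s = - U / V" using UV by (simp add: field_simps add_eq_0_iff)
      then show False using False FD UVF by auto
    qed
    have "b \<noteq> 0" using no_root root ab by auto
    then have e: "b^2 * D = 2 - 2 * a - 3 * a^2" using V0 unfolding V_def mult_eq_0_iff
      by (auto simp: algebra_simps)
    have U0: "U = 0" using UV V0 by simp
    have "heptagon_cubic (- 1 - 2 * a) = U"
    proof -
      have "U = a^3 + a^2 - 2 * a - 1 + (3 * a + 1) * (b^2 * D)"
        unfolding U_def by (simp add: algebra_simps)
      then show ?thesis
        unfolding e heptagon_cubic_def by (simp add: algebra_simps power2_eq_square power3_eq_cube)
    qed
    then show False using no_root U0 FD ab by auto
  qed
qed

text \<open>Clearing denominators at p/q leaves an integer form that is odd unless p and q are both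
  even: modulo 2 the cubic has no root.\<close>

lemma heptagon_cubic_no_rational_root:
  assumes "x \<in> \<rat>"
  shows "heptagon_cubic x \<noteq> 0"
proof
  assume root: "heptagon_cubic x = 0"
  obtain y where y: "x = of_rat y" using assms by (auto elim: Rats_cases)
  obtain p q where pq: "quotient_of y = (p, q)" by force
  have q0: "q > 0" and cop: "coprime p q" using pq quotient_of_denom_pos quotient_of_coprime by auto
  have x: "x = of_int p / of_int q" unfolding y quotient_of_div[OF pq] by (simp add: of_rat_divide)
  have "of_int (p^3 + p^2 * q - 2 * p * q^2 - q^3) = heptagon_cubic x * of_int q ^ 3"
    unfolding heptagon_cubic_def x using q0 by (simp add: field_simps power2_eq_square power3_eq_cube)
  then have "p^3 + p^2 * q - 2 * p * q^2 - q^3 = 0" unfolding root using of_int_eq_0_iff by (metis mult_zero_left)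
  then have "even (p^3 + p^2 * q - 2 * p * q^2 - q^3)" by simp
  then have "even p \<and> even q" by (auto simp: even_add even_diff even_mult_iff)
  then show False using cop by auto
qed

section \<open>Fields along the run of a tree\<close>

text \<open>The invariant of a run. Closure under conjugation serves the \<open>QConj\<close> nodes
  and later puts squared distances between centres into the field.\<close>

definition cubic_free_field :: "complex set \<Rightarrow> bool" where
  "cubic_free_field F \<longleftrightarrow> complex_subfield F \<and> cnj ` F \<subseteq> F \<and> (\<forall>x\<in>F. heptagon_cubic x \<noteq> 0)"

lemma cubic_free_field_Rats: "cubic_free_field \<rat>"
proof -
  have "cnj x \<in> \<rat>" if "x \<in> \<rat>" for x
    using that by (auto elim!: Rats_cases' simp: complex_cnj_divide)
  then show ?thesis
    unfolding cubic_free_field_def complex_subfield_def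
    using heptagon_cubic_no_rational_root by auto
qed

text \<open>Adjoining both \<open>s\<close> and its conjugate keeps the field closed under conjugation.\<close>

lemma cubic_free_field_sqrt:
  assumes F: "cubic_free_field F" and d: "s^2 \<in> F"
  shows "\<exists>K. cubic_free_field K \<and> F \<subseteq> K \<and> s \<in> K"
proof -
  have F1: "complex_subfield F" and F2: "\<And>x. x \<in> F \<Longrightarrow> cnj x \<in> F"
    and F3: "\<forall>x\<in>F. heptagon_cubic x \<noteq> 0"
    using F unfolding cubic_free_field_def by auto
  define G where "G = quad_adjoin F s"
  define K where "K = quad_adjoin G (cnj s)"
  have G: "complex_subfield G" "F \<subseteq> G" "s \<in> G" "\<forall>x\<in>G. heptagon_cubic x \<noteq> 0"
    unfolding G_def using complex_subfield_quad_adjoin heptagon_cubic_quad_adjoin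
      quad_adjoin_superset F1 F3 d by auto
  have d': "(cnj s)^2 \<in> G" using F2[OF d] G(2) by auto
  have K: "complex_subfield K" "G \<subseteq> K" "cnj s \<in> K" "\<forall>x\<in>K. heptagon_cubic x \<noteq> 0"
    unfolding K_def using complex_subfield_quad_adjoin heptagon_cubic_quad_adjoin
      quad_adjoin_superset G d' by auto
  note KD = complex_subfieldD[OF K(1)]
  have GK: "cnj x \<in> K" if xG: "x \<in> G" for x
  proof -
    obtain a b where x: "x = a + b * s" "a \<in> F" "b \<in> F"
      using xG unfolding G_def quad_adjoin_def by blast
    have "cnj a \<in> K" "cnj b \<in> K" using F2 x G(2) K(2) by blast+
    then show ?thesis unfolding x(1) using KD K(3) by simp
  qed
  have "cnj x \<in> K" if x: "x \<in> K" for x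
  proof -
    obtain a b where "x = a + b * cnj s" "a \<in> G" "b \<in> G"
      using x unfolding K_def quad_adjoin_def by blast
    then show ?thesis using GK G K KD by auto
  qed
  then show ?thesis unfolding cubic_free_field_def using K G by (intro exI[of _ K]) auto
qed

text \<open>Only \<open>QSqrt\<close> can leave the field, and it adjoins a number whose square is
  in \<open>F\<close>; for all other operations \<open>K = F\<close> works.\<close>

lemma qop_val_cubic_free:
  assumes F: "cubic_free_field F" and vs: "set vs \<subseteq> F" and v: "qop_val vs op = Some v"
  shows "\<exists>K. cubic_free_field K \<and> F \<subseteq> K \<and> v \<in> K"
proof -
  have F1: "complex_subfield F" and F2: "\<And>x. x \<in> F \<Longrightarrow> cnj x \<in> F"
    using F unfolding cubic_free_field_def by auto
  have n: "vs ! i \<in> F" if "i < length vs" for i using vs that by auto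
  show ?thesis
  proof (cases op)
    case (QSqrt i)
    then have "v^2 \<in> F" using v n by (auto split: if_splits)
    then show ?thesis using cubic_free_field_sqrt F by blast
  qed (use v n F F2 complex_subfieldD[OF F1] complex_subfield_of_int[OF F1]
      in \<open>auto split: if_splits intro!: exI[of _ F]\<close>)
qed

text \<open>The field grows along the branch actually taken, so \<open>F\<close> is generalised in
  the induction; decision nodes add no value.\<close>

lemma qrun_cubic_free:
  assumes "cubic_free_field F" "set vs \<subseteq> F" "qrun T vs = Some os"
  shows "\<exists>K. cubic_free_field K \<and> set os \<subseteq> K"
  using assms
proof (induction T vs arbitrary: F rule: qrun.induct)
  case (1 js vs)
  then have "set os \<subseteq> set vs" by (auto split: if_splits)
  then show ?case using 1 by blast
next
  case (2 op t vs)
  then obtain v where v: "qop_val vs op = Some v" "qrun t (vs @ [v]) = Some os"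
    by (auto split: option.splits)
  obtain K where K: "cubic_free_field K" "F \<subseteq> K" "v \<in> K"
    using qop_val_cubic_free 2 v by metis
  show ?case using "2.IH"[OF v(1) K(1) _ v(2)] 2 K by auto
next
  case (3 i t1 t2 vs)
  then show ?case by (auto split: if_splits)
qed

lemma qtree_constructs_field:
  assumes "qtree_constructs T n c r"
  obtains K where "cubic_free_field K" "\<And>i. i < n \<Longrightarrow> c i \<in> K"
    "\<And>i. i < n \<Longrightarrow> complex_of_real (r i) \<in> K"
proof -
  obtain os where os: "qrun T [] = Some os" "length os = 2 * n"
      "\<forall>i<n. os!i = c i \<and> os!(n+i) = complex_of_real (r i)"
    using assms unfolding qtree_constructs_def by blast
  obtain K where K: "cubic_free_field K" "set os \<subseteq> K"
    using qrun_cubic_free[OF cubic_free_field_Rats _ os(1)] by auto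
  have "os ! k \<in> K" if "k < 2 * n" for k using K(2) os(2) that by auto
  then have "os ! i \<in> K" "os ! (n + i) \<in> K" if "i < n" for i using that by simp_all
  then show ?thesis using that[OF K(1)] os(3) by simp
qed

section \<open>Closed chains of circles tangent to two given circles\<close>

text \<open>Chords of length 2 on a circle of radius \<open>sqrt \<kappa>\<close> subtend an angle x
  with 2 cos x = 2 - 4 / \<kappa>. Never stepping back fixes its sign, so each step is
  multiplication by the same unit number \<open>t\<close>.\<close>

lemma unit_root_of_equal_steps:
  fixes e :: "nat \<Rightarrow> complex"
  assumes norm: "\<And>i. (cmod (e i))^2 = \<kappa>" and "\<kappa> > 0"
    and step: "\<And>i. (cmod (e i - e (Suc i)))^2 = 4"
    and no_return: "\<And>i. e (Suc (Suc i)) \<noteq> e i"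
    and period: "e N = e 0"
  obtains t where "t ^ N = 1" "t \<noteq> 1" "complex_of_real (2 - 4 / \<kappa>) = t + 1 / t"
proof -
  have e0: "e i \<noteq> 0" for i using norm[of i] \<open>\<kappa> > 0\<close> by auto
  define t where "t i = e (Suc i) / e i" for i
  define y where "y = complex_of_real (2 - 4 / \<kappa>)"
  have t0: "t i \<noteq> 0" for i using e0 by (simp add: t_def)
  have quad: "t i + 1 / t i = y" for i
  proof -
    have "cmod (t i) = 1"
      unfolding t_def norm_divide using e0[of i] norm[of i] norm[of "Suc i"]
      by (metis divide_self_if norm_eq_zero norm_ge_zero power2_eq_iff_nonneg)
    then have inv: "1 / t i = cnj (t i)" using t0[of i]
      by (simp add: divide_conv_cnj)
    have "cmod (1 - t i) * cmod (e i) = cmod (e i - e (Suc i))"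
      unfolding norm_mult[symmetric] t_def using e0[of i] by (simp add: left_diff_distrib)
    then have "(cmod (1 - t i))^2 * \<kappa> = 4" using step[of i] norm[of i] by (metis power_mult_distrib)
    then have "(cmod (1 - t i))^2 = 4 / \<kappa>" using \<open>\<kappa> > 0\<close> by (simp add: field_simps)
    moreover have "(cmod (1 - t i))^2 = 2 - 2 * Re (t i)"
      using \<open>cmod (t i) = 1\<close> unfolding cmod_power2
      by (simp add: cmod_def power2_eq_square algebra_simps)
    ultimately have "2 * Re (t i) = 2 - 4 / \<kappa>" by simp
    then show ?thesis unfolding inv complex_add_cnj y_def by simp
  qed
  \<comment> \<open>Consecutive ratios are roots of X^2 - y X + 1, whose roots are mutually inverse;
    inverse ratios would mean \<open>e (Suc (Suc i)) = e i\<close>.\<close>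
  have const: "t (Suc i) = t i" for i
  proof -
    have "(t (Suc i) - t i) * (t (Suc i) * t i - 1) = 
        t (Suc i) * t i * ((t (Suc i) + 1 / t (Suc i)) - (t i + 1 / t i))"
      using t0[of i] t0[of "Suc i"] by (simp add: field_simps)
    then have "(t (Suc i) - t i) * (t (Suc i) * t i - 1) = 0" using quad by simp
    moreover have "t (Suc i) * t i \<noteq> 1"
      unfolding t_def using e0[of i] e0[of "Suc i"] no_return[of i] by (simp add: field_simps)
    ultimately show ?thesis by simp
  qed
  have "t i = t 0" for i by (induction i) (simp_all add: const)
  then have "e (Suc i) = t 0 * e i" for i using e0[of i] by (metis nonzero_eq_divide_eq t_def)
  then have "e i = t 0 ^ i * e 0" for i by (induction i) simp_all
  then have "t 0 ^ N = 1" using period e0[of 0] by (metis mult_cancel_right1)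
  moreover have "t 0 \<noteq> 1" unfolding t_def using e0[of 0] step[of 0] by auto
  ultimately show ?thesis using that[of "t 0"] quad[of 0] y_def by auto
qed

text \<open>Both 2 and -2 are congruent to 2 modulo 4, so an odd number of steps never returns to
  the start.\<close>

lemma steps_parity:
  fixes f :: "nat \<Rightarrow> real"
  assumes "\<And>i. (f i - f (Suc i))^2 = 4"
  shows "\<exists>m::int. f n = f 0 + 2 * real n + 4 * real_of_int m"
proof (induction n)
  case 0
  show ?case by (intro exI[of _ 0]) simp
next
  case (Suc n)
  then obtain m :: int where m: "f n = f 0 + 2 * real n + 4 * real_of_int m" by blast
  have "(f n - f (Suc n) - 2) * (f n - f (Suc n) + 2) = 0"
    using assms[of n] by (simp add: algebra_simps power2_eq_square)
  then consider "f (Suc n) = f n - 2" | "f (Suc n) = f n + 2" by (auto simp: add_eq_0_iff)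
  then show ?case
  proof cases
    case 1
    then show ?thesis using m by (intro exI[of _ "m - 1"]) simp
  next
    case 2
    then show ?thesis using m by (intro exI[of _ m]) simp
  qed
qed

text \<open>The coordinates \<open>(Im z / r, \<rho> / r)\<close> of a circle are, up to a shift of the second one, its
  Lorentzian products with two orthonormal circles perpendicular to the two given circles,
  namely the line of centres and the circle centred at its point \<open>q\<close> on the radical axis.
  If the two given circles touch, then \<open>\<rho> = 0\<close> and the chain is a walk on the line with steps \<open>2\<close>
  or \<open>-2\<close>, which cannot close up after an odd number of steps.\<close>

lemma tangent_chain_normalized:
  fixes z :: "nat \<Rightarrow> complex" and r :: "nat \<Rightarrow> real" and a b d :: real
  assumes "a > 0" "b > 0" and dab: "d \<ge> a + b" and r: "\<And>i. r i > 0"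
    and za: "\<And>i. cmod (z i) = r i + a"
    and zb: "\<And>i. cmod (z i - complex_of_real d) = r i + b"
    and tangent: "\<And>i. cmod (z i - z (Suc i)) = r i + r (Suc i)"
    and disjoint: "\<And>i. cmod (z i - z (Suc (Suc i))) \<ge> r i + r (Suc (Suc i))"
    and period: "z N = z 0" "r N = r 0" and "odd N"
  obtains t where "t ^ N = 1" "t \<noteq> 1"
    "complex_of_real (2 - 4 * ((d^2 - (a + b)^2) / (d^2 - (a - b)^2))) = t + 1 / t"
proof -
  have d0: "d > 0" using assms by linarith
  \<comment> \<open>Subtracting the two tangency equations gives
    \<open>Re (z i) = q + r i * \<mu>\<close>. Here \<open>k\<close> is the power of the point
    \<open>q\<close> with respect to the given circles, and \<open>M\<close>, \<open>L\<close> are 2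
    a b (I + 1) and 2 a b (I - 1) for their inversive distance I.\<close>
  define \<mu> where "\<mu> = (a - b) / d"
  define q where "q = (d^2 + a^2 - b^2) / (2 * d)"
  define k where "k = q^2 - a^2"
  define M where "M = d^2 - (a - b)^2"
  define L where "L = d^2 - (a + b)^2"
  have M0: "M > 0"
  proof -
    have "M = (d - a + b) * (d + a - b)" unfolding M_def by (simp add: algebra_simps power2_eq_square)
    then show ?thesis using assms by simp
  qed
  have L0: "L \<ge> 0"
  proof -
    have "L = (d - a - b) * (d + a + b)" unfolding L_def by (simp add: algebra_simps power2_eq_square)
    then show ?thesis using assms by simp
  qed
  have k_eq: "k = M * L / (4 * d^2)"
    unfolding k_def q_def M_def L_def using d0 by (simp add: field_simps power2_eq_square)
  have k0: "k \<ge> 0" unfolding k_eq using M0 L0 by simp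
  define Y where "Y i = Im (z i)" for i
  have norm_a: "(Re (z i))^2 + (Y i)^2 = (r i + a)^2" for i
    using za[of i] unfolding Y_def by (metis cmod_power2)
  have re: "Re (z i) = q + r i * \<mu>" for i
  proof -
    have "(Re (z i) - d)^2 + (Y i)^2 = (r i + b)^2"
      using zb[of i] cmod_power2[of "z i - complex_of_real d"] unfolding Y_def by simp
    then have "2 * d * Re (z i) = 2 * r i * (a - b) + a^2 - b^2 + d^2"
      using norm_a[of i] by (simp add: algebra_simps power2_eq_square)
    then have "Re (z i) = (2 * r i * (a - b) + a^2 - b^2 + d^2) / (2 * d)" using d0 by (simp add: eq_divide_eq mult.commute)
    also have "\<dots> = q + r i * \<mu>" unfolding q_def \<mu>_def using d0 by (simp add: field_simps)
    finally show ?thesis .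
  qed
  have Y2: "(Y i)^2 = (r i + a)^2 - (q + r i * \<mu>)^2" for i using norm_a[of i] unfolding re by simp
  define \<rho> where "\<rho> = sqrt k"
  have rho2: "\<rho>^2 = k" unfolding \<rho>_def using k0 by simp
  define P where "P i = Complex (Y i / r i) (\<rho> / r i)" for i
  \<comment> \<open>The right side is 2 + 2 I for the inversive distance I of circles
    \<open>i\<close> and \<open>j\<close>: it is 4 for tangent circles and at least 4 for disjoint
    ones.\<close>
  have P_diff: "(cmod (P i - P j))^2 = ((cmod (z i - z j))^2 - (r i - r j)^2) / (r i * r j)" for i j
  proof -
    have zij: "(cmod (z i - z j))^2 = (\<mu> * (r i - r j))^2 + (Y i - Y j)^2"
      unfolding cmod_power2 by (simp add: re Y_def algebra_simps)
    have "(cmod (P i - P j))^2 = (Y i / r i - Y j / r j)^2 + \<rho>^2 * (1 / r i - 1 / r j)^2"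
      unfolding cmod_power2 P_def by (simp add: field_simps power2_eq_square)
    also have "\<dots> = ((Y i * r j - Y j * r i)^2 + k * (r i - r j)^2) / (r i * r j)^2"
      unfolding rho2 using r[of i] r[of j] by (simp add: field_simps power2_eq_square)
    also have "(Y i * r j - Y j * r i)^2 + k * (r i - r j)^2 =
        (Y i)^2 * (r j)^2 + (Y j)^2 * (r i)^2 - 2 * Y i * Y j * r i * r j + k * (r i - r j)^2"
      by (simp add: algebra_simps power2_eq_square)
    also have "\<dots> = r i * r j * ((\<mu> * (r i - r j))^2 + ((Y i)^2 + (Y j)^2 - 2 * Y i * Y j) - (r i - r j)^2)"
      unfolding Y2 k_def by (simp add: algebra_simps power2_eq_square)
    also have "\<dots> = r i * r j * ((cmod (z i - z j))^2 - (r i - r j)^2)"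
      unfolding zij by (simp add: algebra_simps power2_eq_square)
    also have "\<dots> / (r i * r j)^2 = ((cmod (z i - z j))^2 - (r i - r j)^2) / (r i * r j)"
      using r[of i] r[of j] by (simp add: power2_eq_square)
    finally show ?thesis .
  qed
  have step: "(cmod (P i - P (Suc i)))^2 = 4" for i
    unfolding P_diff tangent using r[of i] r[of "Suc i"] by (simp add: field_simps power2_eq_square)
  have no_return: "P (Suc (Suc i)) \<noteq> P i" for i
  proof
    let ?j = "Suc (Suc i)"
    assume "P ?j = P i"
    then have "(cmod (z i - z ?j))^2 = (r i - r ?j)^2"
      using P_diff[of i ?j] r[of i] r[of ?j] by simp
    moreover have "(cmod (z i - z ?j))^2 \<ge> (r i + r ?j)^2"
      by (rule power_mono[OF disjoint]) (use r[of i] r[of ?j] in simp)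
    moreover have "(r i + r ?j)^2 = (r i - r ?j)^2 + 4 * (r i * r ?j)"
      by (simp add: algebra_simps power2_eq_square)
    moreover have "r i * r ?j > 0" using r by simp
    ultimately show False by linarith
  qed
  have PN: "P N = P 0" unfolding P_def Y_def period by simp
  have "L \<noteq> 0"
  proof
    assume "L = 0"
    then have "\<rho> = 0" unfolding \<rho>_def k_eq by simp
    then have "(Y i / r i - Y (Suc i) / r (Suc i))^2 = 4" for i
      using step[of i] unfolding cmod_power2 P_def by simp
    from steps_parity[of "\<lambda>i. Y i / r i", OF this, of N] obtain m :: int where "2 * real N + 4 * real_of_int m = 0"
      using period by (auto simp: Y_def)
    then have "int N + 2 * m = 0" by linarith
    then show False using \<open>odd N\<close> by presburger
  qed
  with L0 have L0: "L > 0" by simp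
  then have k0: "k > 0" and rho0: "\<rho> > 0" unfolding \<rho>_def k_eq using M0 d0 by auto
  \<comment> \<open>The shift that cancels the \<open>1 / r i\<close> term in the squared distance
    from \<open>P i\<close> to \<open>Complex 0 g\<close>, so that all \<open>P i\<close> lie on one
    circle, of squared radius \<open>M / L\<close>.\<close>
  define g where "g = (a - q * \<mu>) / \<rho>"
  have aq: "a - q * \<mu> = (a + b) * M / (2 * d^2)"
    unfolding q_def \<mu>_def M_def using d0 by (simp add: field_simps power2_eq_square)
  have kappa: "1 - \<mu>^2 + g^2 = M / L"
  proof -
    have "1 - \<mu>^2 = M / d^2" unfolding \<mu>_def M_def using d0 by (simp add: field_simps)
    moreover have "g^2 = (a + b)^2 * M / (d^2 * L)"
      unfolding g_def power_divide rho2 aq k_eq using d0 M0 L0 by (simp add: field_simps power2_eq_square)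
    moreover have "(a + b)^2 = d^2 - L" unfolding L_def by simp
    ultimately have "1 - \<mu>^2 + g^2 = M / d^2 + (d^2 - L) * M / (d^2 * L)" by simp
    also have "\<dots> = M / L" using d0 L0 by (simp add: field_simps)
    finally show ?thesis .
  qed
  define e where "e i = P i - Complex 0 g" for i
  have "(cmod (e i))^2 = M / L" for i
  proof -
    have "(cmod (e i))^2 = (Y i)^2 / (r i)^2 + (\<rho>^2 / (r i)^2 - 2 * (g * \<rho>) / r i + g^2)"
      unfolding e_def P_def cmod_power2 by (simp add: power2_diff power_divide)
    also have "g * \<rho> = a - q * \<mu>" unfolding g_def using rho0 by simp
    also have "(Y i)^2 / (r i)^2 + (\<rho>^2 / (r i)^2 - 2 * (a - q * \<mu>) / r i + g^2) = 1 - \<mu>^2 + g^2"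
      unfolding Y2 rho2 k_def using r[of i] by (simp add: field_simps power2_eq_square)
    finally show ?thesis unfolding kappa .
  qed
  moreover have "M / L > 0" using M0 L0 by simp
  moreover have "(cmod (e i - e (Suc i)))^2 = 4" for i using step[of i] unfolding e_def by simp
  moreover have "e (Suc (Suc i)) \<noteq> e i" for i using no_return[of i] unfolding e_def by simp
  moreover have "e N = e 0" unfolding e_def PN ..
  ultimately obtain t where "t ^ N = 1" "t \<noteq> 1" "complex_of_real (2 - 4 / (M / L)) = t + 1 / t"
    using unit_root_of_equal_steps by blast
  then show ?thesis using that[of t] unfolding M_def L_def by simp
qed

text \<open>A rigid motion carries \<open>A\<close> to 0 and \<open>B\<close> to the positive real
  axis. The result is rational in the two radii and the squared distance of the centres, hence stays
  in the field of the packing.\<close>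

lemma tangent_chain:
  fixes c :: "nat \<Rightarrow> complex" and r :: "nat \<Rightarrow> real" and A B :: complex and a b :: real
  assumes "a > 0" "b > 0" and AB: "cmod (B - A) \<ge> a + b" and r: "\<And>i. r i > 0"
    and cA: "\<And>i. cmod (c i - A) = r i + a" and cB: "\<And>i. cmod (c i - B) = r i + b"
    and tangent: "\<And>i. cmod (c i - c (Suc i)) = r i + r (Suc i)"
    and disjoint: "\<And>i. cmod (c i - c (Suc (Suc i))) \<ge> r i + r (Suc (Suc i))"
    and period: "c N = c 0" "r N = r 0" and "odd N"
  obtains t where "t ^ N = 1" "t \<noteq> 1"
    "complex_of_real (2 - 4 * (((cmod (B - A))^2 - (a + b)^2) / ((cmod (B - A))^2 - (a - b)^2)))
       = t + 1 / t"
proof -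
  define d where "d = cmod (B - A)"
  have d0: "d > 0" using assms unfolding d_def by linarith
  define u where "u = cnj (B - A) / complex_of_real d"
  have u1: "cmod u = 1" unfolding u_def norm_divide complex_mod_cnj using d0 by (simp add: d_def)
  define z where "z i = (c i - A) * u" for i
  have "(B - A) * u = complex_of_real d"
    unfolding u_def times_divide_eq_right complex_norm_square[symmetric] d_def[symmetric]
    using d0 by (simp add: power2_eq_square)
  then have zB: "z i - complex_of_real d = (c i - B) * u" for i
    unfolding z_def by (simp add: algebra_simps)
  have zz: "z i - z j = (c i - c j) * u" for i j unfolding z_def by (simp add: algebra_simps)
  show ?thesis
    by (rule tangent_chain_normalized[of a b d r z N])
      (use assms that in \<open>simp_all add: zB zz norm_mult u1 d_def[symmetric]\<close>, simp_all add: z_def norm_mult u1 assms)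
qed

text \<open>The seventh cyclotomic polynomial is palindromic; divided by \<open>t^3\<close> it
  becomes this cubic in \<open>t + 1 / t\<close>.\<close>

lemma heptagon_cubic_root:
  assumes "t ^ 7 = 1" "t \<noteq> 1"
  shows "heptagon_cubic (t + 1 / t) = 0"
proof -
  have t0: "t \<noteq> 0" using assms(1) by auto
  have "(t - 1) * (t^6 + t^5 + t^4 + t^3 + t^2 + t + 1) = t ^ 7 - 1"
    by (simp add: algebra_simps eval_nat_numeral)
  then have "t^6 + t^5 + t^4 + t^3 + t^2 + t + 1 = 0" using assms by simp
  moreover have "heptagon_cubic (t + 1 / t) * t^3 = t^6 + t^5 + t^4 + t^3 + t^2 + t + 1"
    unfolding heptagon_cubic_def using t0 by (simp add: field_simps eval_nat_numeral)
  ultimately show ?thesis using t0 by simp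
qed

section \<open>Bipyramids\<close>

text \<open>Vertices below \<open>n\<close> are the rim, \<open>n\<close> and \<open>Suc n\<close>
  the apexes, not adjacent to each other. The condition \<open>i \<noteq> j\<close> excludes a loop
  when \<open>n = 1\<close>.\<close>

definition bipyramid :: "nat \<Rightarrow> nat \<Rightarrow> nat \<Rightarrow> bool" where
  "bipyramid n i j \<longleftrightarrow>
     (i < n \<and> j < n \<and> i \<noteq> j \<and> (j = Suc i mod n \<or> i = Suc j mod n)) \<or>
     (i < n \<and> (j = n \<or> j = Suc n)) \<or> (j < n \<and> (i = n \<or> i = Suc n))"

lemma simple_graph_bipyramid: "simple_graph (n + 2) (bipyramid n)"
  unfolding simple_graph_def bipyramid_def by auto

section \<open>Packings of the heptagonal bipyramid are not constructible\<close>

text \<open>Otherwise the point dividing the segment in the ratio \<open>r\<close> :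
  \<open>s\<close> lies in both balls.\<close>

lemma dist_ge_if_disjoint_balls:
  fixes x y :: "'a::real_normed_vector"
  assumes disj: "ball x r \<inter> ball y s = {}" and "r > 0" "s > 0"
  shows "dist x y \<ge> r + s"
proof (rule ccontr)
  assume "\<not> r + s \<le> dist x y"
  then have less: "dist x y < r + s" by simp
  define u where "u = r / (r + s)"
  have u: "0 < u" "0 < 1 - u" unfolding u_def using assms(2,3) by (simp_all add: field_simps)
  define p where "p = x + u *\<^sub>R (y - x)"
  have "dist x p = u * dist x y" unfolding p_def dist_norm using u by (simp add: norm_minus_commute)
  also have "\<dots> < u * (r + s)" using less u by simp
  also have "\<dots> = r" unfolding u_def using assms(2,3) by simp
  finally have px: "p \<in> ball x r" by simp
  have "y - p = (1 - u) *\<^sub>R (y - x)" unfolding p_def by (simp add: algebra_simps)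
  then have "dist y p = (1 - u) * dist x y" unfolding dist_norm using u by (simp add: norm_minus_commute)
  also have "\<dots> < (1 - u) * (r + s)" using less u by simp
  also have "\<dots> = s" unfolding u_def using assms(2,3) by (simp add: field_simps)
  finally show False using px disj by auto
qed

lemma bipyramid_packing_not_constructible:
  assumes pack: "circle_packing (7 + 2) (bipyramid 7) c r"
  shows "\<not> qtree_constructs T (7 + 2) c r"
proof
  assume "qtree_constructs T (7 + 2) c r"
  then obtain K where K: "cubic_free_field K" and cK: "\<And>i. i < 7 + 2 \<Longrightarrow> c i \<in> K"
    and rK: "\<And>i. i < 7 + 2 \<Longrightarrow> complex_of_real (r i) \<in> K"
    by (rule qtree_constructs_field) blast
  have r0: "r i > 0" if "i < 9" for i using pack that unfolding circle_packing_def by simp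
  have disj: "cmod (c i - c j) \<ge> r i + r j" if "i < 9" "j < 9" "i \<noteq> j" for i j
    using dist_ge_if_disjoint_balls[of "c i" "r i" "c j" "r j"] pack that r0[of i] r0[of j]
    unfolding circle_packing_def dist_norm by simp
  have tang: "cmod (c i - c j) = r i + r j" if "bipyramid 7 i j" "i < 9" "j < 9" for i j
    using pack that unfolding circle_packing_def by simp
  define y where "y = 2 - 4 * (((cmod (c 8 - c 7))^2 - (r 7 + r 8)^2) /
      ((cmod (c 8 - c 7))^2 - (r 7 - r 8)^2))"
  obtain t where t: "t ^ 7 = 1" "t \<noteq> 1" "complex_of_real y = t + 1 / t"
  \<comment> \<open>Reducing indices modulo 7 turns the rim into a periodic sequence;
    \<open>A\<close> is \<open>c 7\<close> and \<open>B\<close> is \<open>c 8\<close>.\<close>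
  proof (rule tangent_chain[of "r 7" "r 8" "c 8" "c 7" "\<lambda>i. r (i mod 7)" "\<lambda>i. c (i mod 7)" 7])
    have m: "i mod 7 < 7" "i mod 7 < 9" for i :: nat
      using mod_less_divisor[of 7 i] by linarith+
    have ne: "i mod 7 \<noteq> Suc i mod 7" "i mod 7 \<noteq> Suc (Suc i) mod 7" for i :: nat by presburger+
    show "r 7 > 0" "r 8 > 0" "r (i mod 7) > 0" for i using r0 m by auto
    show "r 7 + r 8 \<le> cmod (c 8 - c 7)" using disj[of 8 7] by simp
    show "cmod (c (i mod 7) - c 7) = r (i mod 7) + r 7"
      "cmod (c (i mod 7) - c 8) = r (i mod 7) + r 8" for i
      by (rule tang; use m[of i] in \<open>simp add: bipyramid_def\<close>)+
    show "cmod (c (i mod 7) - c (Suc i mod 7)) = r (i mod 7) + r (Suc i mod 7)" for i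
      by (rule tang) (use m[of i] m[of "Suc i"] ne[of i] in \<open>simp_all add: bipyramid_def mod_Suc_eq\<close>)
    show "r (i mod 7) + r (Suc (Suc i) mod 7) \<le> cmod (c (i mod 7) - c (Suc (Suc i) mod 7))" for i
      by (rule disj) (use m ne in auto)
  qed (auto simp: y_def)
  have "heptagon_cubic (complex_of_real y) = 0" unfolding t(3) using heptagon_cubic_root t by blast
  moreover have "complex_of_real y \<in> K"
  proof -
    have F: "complex_subfield K" and cn: "\<And>x. x \<in> K \<Longrightarrow> cnj x \<in> K"
      using K unfolding cubic_free_field_def by auto
    note FD = complex_subfieldD[OF F] complex_subfield_numeral[OF F]
    have e: "complex_of_real ((cmod (c 8 - c 7))^2) = (c 8 - c 7) * cnj (c 8 - c 7)"
      by (rule complex_norm_square)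
    have "c 8 - c 7 \<in> K" using cK FD by simp
    then have "complex_of_real ((cmod (c 8 - c 7))^2) \<in> K" unfolding e by (intro FD(5) cn)
    moreover have "complex_of_real (r 7) \<in> K" "complex_of_real (r 8) \<in> K" using rK by auto
    ultimately show ?thesis
      unfolding y_def of_real_diff of_real_add of_real_mult of_real_divide of_real_power of_real_numeral
      using FD by simp
  qed
  ultimately show False using K unfolding cubic_free_field_def by blast
qed

section \<open>Existence of packings by inversion\<close>

text \<open>Inverting a family of discs in the unit circle. A negative radius encodes the exterior of a
  disc, so that internal tangency also reads \<open>|c - c'| = |r + r'|\<close>.\<close>

lemma circle_packing_inversion:
  fixes c :: "nat \<Rightarrow> complex" and r :: "nat \<Rightarrow> real"
  defines "D \<equiv> \<lambda>i. (cmod (c i))^2 - (r i)^2"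
  assumes pos: "\<And>i. i < n \<Longrightarrow> r i / D i > 0"
    and tangent: "\<And>i j. i < n \<Longrightarrow> j < n \<Longrightarrow> E i j \<Longrightarrow> (cmod (c i - c j))^2 = (r i + r j)^2"
    and disjoint: "\<And>i j. i < n \<Longrightarrow> j < n \<Longrightarrow> i \<noteq> j \<Longrightarrow>
      ((cmod (c i - c j))^2 - (r i + r j)^2) / (D i * D j) \<ge> 0"
  shows "circle_packing n E (\<lambda>i. c i / complex_of_real (D i)) (\<lambda>i. r i / D i)"
proof -
  \<comment> \<open>\<open>D i\<close> is the power of the origin, so inversion sends centre and
    radius to their quotients by \<open>D i\<close>. The defect from external tangency is divided by
    \<open>D i * D j\<close>, so tangency persists.\<close>
  have key: "(cmod (c i / complex_of_real (D i) - c j / complex_of_real (D j)))^2 =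
      (r i / D i + r j / D j)^2 + ((cmod (c i - c j))^2 - (r i + r j)^2) / (D i * D j)"
    if "i < n" "j < n" for i j
  proof -
    define x y x' y' where xy: "x = Re (c i)" "y = Im (c i)" "x' = Re (c j)" "y' = Im (c j)"
    have D0: "D i \<noteq> 0" "D j \<noteq> 0" using pos that by force+
    have Di: "(r i)^2 = x^2 + y^2 - D i" "(r j)^2 = x'^2 + y'^2 - D j"
      unfolding D_def xy cmod_power2 by simp_all
    have "(cmod (c i / complex_of_real (D i) - c j / complex_of_real (D j)))^2 =
        (x / D i - x' / D j)^2 + (y / D i - y' / D j)^2"
      unfolding cmod_power2 xy by simp
    also have "\<dots> = ((x^2 + y^2) * (D j)^2 + (x'^2 + y'^2) * (D i)^2 - 2 * (x * x' + y * y') * (D i * D j))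
        / (D i * D j)^2"
      using D0 by (simp add: field_simps power2_eq_square)
    also have "\<dots> = ((r i)^2 * (D j)^2 + (r j)^2 * (D i)^2 +
        ((x - x')^2 + (y - y')^2 - (r i)^2 - (r j)^2) * (D i * D j)) / (D i * D j)^2"
      unfolding Di by (simp add: algebra_simps power2_eq_square)
    also have "\<dots> = (r i / D i + r j / D j)^2 + ((x - x')^2 + (y - y')^2 - (r i + r j)^2) / (D i * D j)"
      using D0 by (simp add: field_simps power2_eq_square)
    also have "(x - x')^2 + (y - y')^2 = (cmod (c i - c j))^2" unfolding cmod_power2 xy by simp
    finally show ?thesis .
  qed
  show ?thesis unfolding circle_packing_def
  proof (intro conjI allI impI)
    fix i j assume ij: "i < n" "j < n"
    let ?d = "cmod (c i / complex_of_real (D i) - c j / complex_of_real (D j))"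
    have p: "r i / D i + r j / D j \<ge> 0" using pos ij by (simp add: less_imp_le)
    { assume "i \<noteq> j"
      then have "?d^2 \<ge> (r i / D i + r j / D j)^2" using key disjoint ij by simp
      then have "?d \<ge> r i / D i + r j / D j" by (rule power2_le_imp_le) simp
      then show "ball (c i / complex_of_real (D i)) (r i / D i) \<inter>
          ball (c j / complex_of_real (D j)) (r j / D j) = {}"
        by (intro disjoint_ballI) (simp add: dist_norm) }
    { assume "E i j"
      then have "?d^2 = (r i / D i + r j / D j)^2" using key tangent ij by simp
      then show "?d = r i / D i + r j / D j" using p by (simp add: power2_eq_iff_nonneg) }
  qed (use pos in auto)
qed

lemma cmod_cis_diff: "(cmod (cis x - cis y))^2 = 4 * (sin ((x - y) / 2))^2"
proof -
  have "(cmod (cis x - cis y))^2 = 2 - 2 * cos (x - y)"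
    unfolding cmod_power2 cos_diff using sin_cos_squared_add[of x] sin_cos_squared_add[of y]
    by (simp add: power2_eq_square algebra_simps)
  also have "cos (x - y) = 1 - 2 * (sin ((x - y) / 2))^2"
    using cos_double_sin[of "(x - y) / 2"] by (simp only: mult_2 field_sum_of_halves)
  finally show ?thesis by simp
qed

lemma sin_ge_sin_between:
  fixes x \<delta> :: real
  assumes "0 \<le> \<delta>" "\<delta> \<le> x" "x \<le> pi - \<delta>"
  shows "sin \<delta> \<le> sin x"
proof (cases "x \<le> pi / 2")
  case True
  then show ?thesis using assms by (intro sin_monotone_2pi_le) auto
next
  case False
  have "sin \<delta> \<le> sin (pi - x)" using False assms by (intro sin_monotone_2pi_le) auto
  then show ?thesis by simp
qed

text \<open>Before the inversion, the apexes are concentric circles around \<open>0\<close> and the rim is a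
  regular ring of circles between them; the centre of inversion \<open>1\<close> lies in a gap of the ring.\<close>

lemma bipyramid_packing_exists:
  assumes n: "n \<ge> 3"
  shows "\<exists>c r. circle_packing (n + 2) (bipyramid n) c r"
proof -
  \<comment> \<open>Neighbouring rim centres are 2 sin (pi / n) apart. The half-step offset in
    \<open>\<theta>\<close> centres a gap at angle 0, and subtracting 1 in \<open>c\<close> moves
    the centre of inversion to the origin.\<close>
  define s where "s = sin (pi / n)"
  define \<theta> where "\<theta> i = pi * (2 * real i + 1) / n" for i :: nat
  define c where "c i = (if i < n then cis (\<theta> i) else 0) - 1" for i
  define r where "r i = (if i < n then s else if i = n then 1 - s else - (1 + s))" for i
  define D where "D i = (cmod (c i))^2 - (r i)^2" for i
  have npos: "real n > 0" using n by simp
  have pn: "0 < pi / n" "pi / n < pi / 2" using n by (simp_all add: field_simps)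
  have s: "0 < s" "s < 1"
    unfolding s_def using pn sin_gt_zero2 sin_monotone_2pi[of "pi / n" "pi / 2"] by auto
  have rim_dist: "(cmod (cis (\<theta> i) - cis (\<theta> j)))^2 \<ge> 4 * s^2" if "i < n" "j < n" "i \<noteq> j" for i j
  proof -
    have *: "(cmod (cis (\<theta> i) - cis (\<theta> j)))^2 \<ge> 4 * s^2" if "j < i" "i < n" for i j
    proof -
      have e: "(\<theta> i - \<theta> j) / 2 = pi / n * real (i - j)"
        unfolding \<theta>_def using that npos by (simp add: field_simps of_nat_diff)
      have "pi / n * 1 \<le> pi / n * real (i - j)" "pi / n * real (i - j) \<le> pi / n * (real n - 1)"
        using that by (intro mult_left_mono; simp)+
      moreover have "pi / n * (real n - 1) = pi - pi / n" using npos by (simp add: field_simps)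
      ultimately have "s \<le> sin ((\<theta> i - \<theta> j) / 2)"
        unfolding s_def e using pn by (intro sin_ge_sin_between) linarith+
      then have "s^2 \<le> (sin ((\<theta> i - \<theta> j) / 2))^2" using s by (intro power_mono) auto
      then show ?thesis unfolding cmod_cis_diff by simp
    qed
    then show ?thesis using that by (metis linorder_neqE_nat norm_minus_commute)
  qed
  have rim_tangent: "(cmod (cis (\<theta> i) - cis (\<theta> (Suc i mod n))))^2 = 4 * s^2" if "i < n" for i
  proof -
    have "cis (\<theta> (Suc i mod n)) = cis (\<theta> (Suc i))"
    proof (cases "Suc i = n")
      case True
      have "\<theta> n = \<theta> 0 + 2 * pi" unfolding \<theta>_def using npos by (simp add: field_simps)
      then have "cis (\<theta> n) = cis (\<theta> 0)" by (simp add: cis_mult[symmetric])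
      then show ?thesis using True by simp
    qed (use that in simp)
    moreover have "(\<theta> i - \<theta> (Suc i)) / 2 = - (pi / n)" unfolding \<theta>_def using npos by (simp add: field_simps)
    ultimately show ?thesis using cmod_cis_diff[of "\<theta> i" "\<theta> (Suc i)"] unfolding s_def by simp
  qed
  \<comment> \<open>The point 1 is outside each rim circle: with \<open>\<delta>\<close> = pi / (2
    n), its distance to a rim centre is at least 2 sin \<delta>, which exceeds 2 sin \<delta> cos
    \<delta> = \<open>s\<close>.\<close>
  have D_rim: "D i > 0" if "i < n" for i
  proof -
    have c2: "(cmod (c i))^2 = 4 * (sin (\<theta> i / 2))^2"
      using cmod_cis_diff[of "\<theta> i" 0] that unfolding c_def by simp
    define \<delta> where "\<delta> = pi / (2 * n)"
    have \<delta>: "0 < \<delta>" "\<delta> < pi / 2" "pi / n = 2 * \<delta>" unfolding \<delta>_def using n by (simp_all add: field_simps)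
    have "\<theta> i / 2 = \<delta> * (2 * real i + 1)" unfolding \<theta>_def \<delta>_def by simp
    moreover have "\<delta> * 1 \<le> \<delta> * (2 * real i + 1)" "\<delta> * (2 * real i + 1) \<le> \<delta> * (2 * real n - 1)"
      using \<delta> that by (intro mult_left_mono; simp)+
    moreover have "\<delta> * (2 * real n - 1) = pi - \<delta>" unfolding \<delta>_def using npos by (simp add: field_simps)
    ultimately have "sin \<delta> \<le> sin (\<theta> i / 2)" using \<delta> by (intro sin_ge_sin_between) auto
    moreover have sd: "sin \<delta> > 0" using \<delta> sin_gt_zero2 by auto
    moreover have "s < 2 * sin \<delta>"
    proof -
      have "cos \<delta> < 1" using cos_monotone_0_pi[of 0 \<delta>] \<delta> by simp
      then show ?thesis unfolding s_def \<delta>(3) sin_double using sd by simp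
    qed
    ultimately have "s^2 < (2 * sin (\<theta> i / 2))^2" using s by (intro power_strict_mono) auto
    then show ?thesis unfolding D_def c2 r_def using that by simp
  qed
  have D_in: "D n > 0"
  proof -
    have "D n = s * (2 - s)" unfolding D_def c_def r_def by (simp add: algebra_simps power2_eq_square)
    then show ?thesis using s by simp
  qed
  \<comment> \<open>The origin is inside the outer apex circle, so its negative radius becomes
    positive after division by \<open>D (Suc n)\<close>.\<close>
  have D_out: "D (Suc n) < 0"
  proof -
    have "D (Suc n) = - (s * (2 + s))" unfolding D_def c_def r_def by (simp add: algebra_simps power2_eq_square)
    then show ?thesis using s by simp
  qed
  have cases: "i < n \<or> i = n \<or> i = Suc n" if "i < n + 2" for i using that by auto
  have rim_rim: "(cmod (c i - c j))^2 = (cmod (cis (\<theta> i) - cis (\<theta> j)))^2" "r i + r j = 2 * s"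
    if "i < n" "j < n" for i j
    using that by (simp_all add: c_def r_def)
  have rim_apex: "(cmod (c i - c j))^2 = (r i + r j)^2"
      "(cmod (c j - c i))^2 = (r j + r i)^2" if "i < n" "j = n \<or> j = Suc n" for i j
    using that by (auto simp: c_def r_def)
  have "circle_packing (n + 2) (bipyramid n)
     (\<lambda>i. c i / complex_of_real ((cmod (c i))^2 - (r i)^2)) (\<lambda>i. r i / ((cmod (c i))^2 - (r i)^2))"
  proof (rule circle_packing_inversion, unfold D_def[symmetric])
    show "r i / D i > 0" if "i < n + 2" for i
      using cases[OF that] D_rim D_in D_out s
      by (auto simp: r_def divide_pos_pos divide_neg_neg)
    show "(cmod (c i - c j))^2 = (r i + r j)^2" if "i < n + 2" "j < n + 2" "bipyramid n i j" for i j
    proof -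
      consider "i < n" "j < n" "j = Suc i mod n" | "i < n" "j < n" "i = Suc j mod n" |
        "i < n" "j = n \<or> j = Suc n" | "j < n" "i = n \<or> i = Suc n"
        using \<open>bipyramid n i j\<close> unfolding bipyramid_def by blast
      then show ?thesis
      proof cases
        case 1
        then show ?thesis using rim_rim[of i j] rim_tangent[of i] by (simp add: power_mult_distrib)
      next
        case 2
        then show ?thesis using rim_rim[of i j] rim_tangent[of j]
          by (simp add: power_mult_distrib norm_minus_commute)
      next
        case 3
        then show ?thesis using rim_apex by blast
      next
        case 4
        then show ?thesis using rim_apex by blast
      qed
    qed
    show "0 \<le> ((cmod (c i - c j))^2 - (r i + r j)^2) / (D i * D j)"
      if ij: "i < n + 2" "j < n + 2" "i \<noteq> j" for i j
    proof -
      consider "i < n" "j < n" | "i < n" "j = n \<or> j = Suc n" | "j < n" "i = n \<or> i = Suc n" |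
        "i = n" "j = Suc n" | "j = n" "i = Suc n"
        using cases[OF ij(1)] cases[OF ij(2)] ij(3) by metis
      then show ?thesis
      proof cases
        case 1
        have "(cmod (c i - c j))^2 - (r i + r j)^2 \<ge> 0"
          using rim_dist[of i j] rim_rim[of i j] 1 that by (simp add: power_mult_distrib)
        then show ?thesis using D_rim 1 by (simp add: less_imp_le)
      next
        case 2
        then show ?thesis using rim_apex by simp
      next
        case 3
        then show ?thesis using rim_apex by simp
      next
        case 4
        \<comment> \<open>The apexes are concentric with signed radii adding up to
          \<open>- 2 * s\<close>, so the numerator is nonpositive; the opposite signs of
          \<open>D\<close> make the quotient nonnegative.\<close>
        have "D i * D j < 0" using 4 D_in D_out by (simp add: mult_pos_neg)
        moreover have "(cmod (c i - c j))^2 - (r i + r j)^2 \<le> 0" using 4 by (simp add: c_def)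
        ultimately show ?thesis by (simp add: divide_nonpos_neg)
      next
        case 5
        have "D i * D j < 0" using 5 D_in D_out by (simp add: mult_neg_pos)
        moreover have "(cmod (c i - c j))^2 - (r i + r j)^2 \<le> 0" using 5 by (simp add: c_def)
        ultimately show ?thesis by (simp add: divide_nonpos_neg)
      qed
    qed
  qed
  then show ?thesis by blast
qed

theorem theorem7:
  shows "\<exists>n E. simple_graph n E \<and> (\<exists>c r. circle_packing n E c r) \<and>
           (\<forall>c r. circle_packing n E c r \<longrightarrow> (\<forall>T. \<not> qtree_constructs T n c r))"
  using simple_graph_bipyramid[of 7] bipyramid_packing_exists[of 7]
    bipyramid_packing_not_constructible by (intro exI[of _ "7 + 2"] exI[of _ "bipyramid 7"]) auto

end
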